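(* Let $G$ be a unicyclic graph with $n \geq 4$ vertices. For $0 \leq \alpha < 1$, $\gamma_\alpha(G) \leq \gamma_\alpha(S_n + e)$, with equality if and only if $G \cong S_n + e$.
   Context: All graphs are finite, simple and undirected. For a graph $G$, $A(G)$ is its adjacency matrix and $D(G)$ the diagonal matrix of vertex degrees. For $\alpha\in[0,1]$, $A_\alpha(G) = \alpha D(G) + (1-\alpha)A(G)$, $\rho_\alpha(G)$ is the largest eigenvalue of $A_\alpha(G)$, and $\gamma_\alpha(G) = \Delta(G) - \rho_\alpha(G)$ where $\Delta(G)$ is the maximum degree of $G$. A unicyclic graph is a connected graph with exactly one cycle. For $n\ge 3$, $S_n + e$ is the graph obtained from the star $S_n$ on $n$ vertices by adding an edge joining two of its vertices of degree one. *)

theory Defs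
  imports "Graph_Theory.Graph_Theory" "Jordan_Normal_Form.Char_Poly"
begin

text \<open>
  Finite simple undirected graphs are the \<^locale>\<open>pair_graph\<close>s of the library, i.e. finite,
  loop-free, symmetric digraphs; an undirected edge is a pair of opposite arcs, so the degree of a
  vertex is its out-degree.
\<close>

definition max_degree :: "'a pair_pre_digraph \<Rightarrow> nat" where
  "max_degree G = Max (out_degree (with_proj G) ` pverts G)"

text \<open>
  Matrices are indexed by \<open>0..<n\<close>, so the vertices are enumerated by an arbitrary but fixed list;
  another enumeration conjugates the matrices below by a permutation matrix and leaves their
  eigenvalues unchanged.
\<close>

definition vertex_list :: "'a pair_pre_digraph \<Rightarrow> 'a list" where
  "vertex_list G = (SOME vs. distinct vs \<and> set vs = pverts G)"

lemma vertex_list: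
  assumes "finite (pverts G)"
  shows "distinct (vertex_list G)" and "set (vertex_list G) = pverts G"
proof -
  have "\<exists>vs. distinct vs \<and> set vs = pverts G"
    using finite_distinct_list[OF assms] by blast
  then have "distinct (vertex_list G) \<and> set (vertex_list G) = pverts G"
    unfolding vertex_list_def by (rule someI_ex)
  then show "distinct (vertex_list G)" and "set (vertex_list G) = pverts G"
    by auto
qed

definition adjacency_matrix :: "'a pair_pre_digraph \<Rightarrow> real mat" where
  "adjacency_matrix G = (let vs = vertex_list G; n = card (pverts G) in
     mat n n (\<lambda>(i, j). if (vs ! i, vs ! j) \<in> parcs G then 1 else 0))"

definition degree_matrix :: "'a pair_pre_digraph \<Rightarrow> real mat" where
  "degree_matrix G = (let vs = vertex_list G; n = card (pverts G) in
     mat n n (\<lambda>(i, j). if i = j then real (out_degree (with_proj G) (vs ! i)) else 0))"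

definition A_alpha :: "real \<Rightarrow> 'a pair_pre_digraph \<Rightarrow> real mat" where
  "A_alpha \<alpha> G = \<alpha> \<cdot>\<^sub>m degree_matrix G + (1 - \<alpha>) \<cdot>\<^sub>m adjacency_matrix G"

definition rho_alpha :: "real \<Rightarrow> 'a pair_pre_digraph \<Rightarrow> real" where
  "rho_alpha \<alpha> G = Max {k. eigenvalue (A_alpha \<alpha> G) k}"

definition gamma_alpha :: "real \<Rightarrow> 'a pair_pre_digraph \<Rightarrow> real" where
  "gamma_alpha \<alpha> G = real (max_degree G) - rho_alpha \<alpha> G"

text \<open>
  The closed walks counted as cycles by the library include \<open>u, v, u\<close>, and each undirected cycle
  arises from several of them (starting point, direction). A cycle of an undirected graph is
  therefore represented by its set of undirected edges, and has length at least 3.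
\<close>

definition undirected_cycles :: "'a pair_pre_digraph \<Rightarrow> 'a set set set" where
  "undirected_cycles G =
     {(\<lambda>(u, v). {u, v}) ` set p | p. pre_digraph.cycle (with_proj G) p \<and> 3 \<le> length p}"

definition unicyclic :: "'a pair_pre_digraph \<Rightarrow> bool" where
  "unicyclic G \<longleftrightarrow> pair_graph G \<and> Digraph_Component.connected (with_proj G) \<and>
     (\<exists>!C. C \<in> undirected_cycles G)"

definition star_graph :: "nat \<Rightarrow> nat pair_pre_digraph" where
  "star_graph n = \<lparr>pverts = {0..<n}, parcs = {0} \<times> {1..<n} \<union> {1..<n} \<times> {0}\<rparr>"

text \<open>
  The centre of the star is \<open>0\<close>; the vertices \<open>1\<close> and \<open>2\<close> are leaves of it for \<open>n \<ge> 3\<close>.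
\<close>

definition star_plus_edge :: "nat \<Rightarrow> nat pair_pre_digraph" where
  "star_plus_edge n =
     \<lparr>pverts = pverts (star_graph n), parcs = parcs (star_graph n) \<union> {(1, 2), (2, 1)}\<rparr>"

end

theory Submission
  imports Defs "HOL-Analysis.Function_Topology"
begin

text \<open>
  If \<open>G\<close> has a vertex of degree \<open>n - 1\<close>, every edge avoiding it closes a triangle with it, so
  unicyclicity forces \<open>G\<close> to be \<open>S\<^sub>n + e\<close>. Otherwise \<open>G\<close> has maximum degree \<open>d \<le> n - 2\<close>, and the inequality
  is strict: with \<open>r = \<rho>\<^sub>\<alpha>(S\<^sub>n + e)\<close> and \<open>\<kappa> = d - (n - 1 - r)\<close>, the test vector that is \<open>1\<close> at a vertex of
  degree \<open>d\<close>, \<open>(1 - \<alpha>) / (\<kappa> - \<alpha>)\<close> at its neighbours (\<open>1\<close> if \<open>\<kappa> \<le> \<alpha>\<close>) and \<open>0\<close> elsewhere has Rayleigh quotient greater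
  than \<open>\<kappa>\<close>. This is checked with the equation that the eigenvector of \<open>S\<^sub>n + e\<close> imposes on \<open>r\<close>.
\<close>

section \<open>Eigenvalues and the Rayleigh quotient\<close>

text \<open>The entries of \<open>A_alpha\<close> are indexed here by vertices instead of positions,
  so that eigenvectors become functions on the vertices and the choice of \<open>vertex_list\<close>
  disappears from the later arguments.\<close>

definition A_entry :: "real \<Rightarrow> 'a pair_pre_digraph \<Rightarrow> 'a \<Rightarrow> 'a \<Rightarrow> real" where
  "A_entry \<alpha> G v w = \<alpha> * (if v = w then real (out_degree (with_proj G) v) else 0) +
     (1 - \<alpha>) * (if (v, w) \<in> parcs G then 1 else 0)"

text \<open>Enumerating the vertices is a bijection from positions to vertices; reindexing the sums
  along it turns eigenvectors into vertex functions and back. Values of \<open>f\<close> outside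
  \<open>pverts G\<close> are irrelevant.\<close>

lemma eigenvalue_A_alpha_iff:
  assumes fin: "finite (pverts G)"
  shows "eigenvalue (A_alpha \<alpha> G) k \<longleftrightarrow>
    (\<exists>f. (\<exists>v\<in>pverts G. f v \<noteq> 0) \<and>
      (\<forall>v\<in>pverts G. (\<Sum>w\<in>pverts G. A_entry \<alpha> G v w * f w) = k * f v))"
proof -
  define n where "n = card (pverts G)"
  define vs where "vs = vertex_list G"
  have vs: "distinct vs" "set vs = pverts G" "length vs = n"
    using vertex_list[OF fin] distinct_card[of "vertex_list G"] by (auto simp: vs_def n_def)
  have bij: "bij_betw (\<lambda>i. vs ! i) {0..<n} (pverts G)"
    using bij_betw_nth[OF vs(1)] vs(2,3) by (simp add: lessThan_atLeast0)
  have dim: "A_alpha \<alpha> G \<in> carrier_mat n n"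
    by (simp add: A_alpha_def degree_matrix_def adjacency_matrix_def Let_def n_def)
  have ent: "A_alpha \<alpha> G $$ (i, j) = A_entry \<alpha> G (vs ! i) (vs ! j)" if "i < n" "j < n" for i j
    using that vs nth_eq_iff_index_eq[OF vs(1), of i j]
    by (simp add: A_alpha_def degree_matrix_def adjacency_matrix_def Let_def n_def[symmetric]
        vs_def[symmetric] A_entry_def)
  have mult: "(A_alpha \<alpha> G *\<^sub>v v) $ i =
      (\<Sum>w\<in>pverts G. A_entry \<alpha> G (vs ! i) w * f w)"
    if "v \<in> carrier_vec n" "\<And>j. j < n \<Longrightarrow> v $ j = f (vs ! j)" "i < n" for v f i
  proof -
    have "(A_alpha \<alpha> G *\<^sub>v v) $ i = (\<Sum>j\<in>{0..<n}. A_entry \<alpha> G (vs ! i) (vs ! j) * f (vs ! j))"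
      using that dim by (auto simp: scalar_prod_def ent intro!: sum.cong)
    also have "\<dots> = (\<Sum>w\<in>pverts G. A_entry \<alpha> G (vs ! i) w * f w)"
      by (rule sum.reindex_bij_betw[OF bij])
    finally show ?thesis .
  qed
  show ?thesis
  proof
    assume "eigenvalue (A_alpha \<alpha> G) k"
    then obtain v where v: "v \<in> carrier_vec n" "v \<noteq> 0\<^sub>v n" "A_alpha \<alpha> G *\<^sub>v v = k \<cdot>\<^sub>v v"
      using dim by (auto simp: eigenvalue_def eigenvector_def)
    define f where "f u = v $ (the_inv_into {0..<n} (\<lambda>i. vs ! i) u)" for u
    have f: "v $ j = f (vs ! j)" if "j < n" for j
      using that bij by (simp add: f_def bij_betw_def the_inv_into_f_f)
    obtain i where i: "i < n" "v $ i \<noteq> 0"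
      using v(1,2) by (metis carrier_vecD eq_vecI index_zero_vec(1) index_zero_vec(2))
    have "\<exists>u\<in>pverts G. f u \<noteq> 0"
      using i f vs by (metis nth_mem)
    moreover have "(\<Sum>w\<in>pverts G. A_entry \<alpha> G u w * f w) = k * f u" if "u \<in> pverts G" for u
    proof -
      obtain j where j: "j < n" "u = vs ! j"
        using \<open>u \<in> pverts G\<close> unfolding vs(2)[symmetric] in_set_conv_nth vs(3) by blast
      then show ?thesis
        using mult[OF v(1) f j(1)] v(1,3) f by simp
    qed
    ultimately show "\<exists>f. (\<exists>v\<in>pverts G. f v \<noteq> 0) \<and>
      (\<forall>v\<in>pverts G. (\<Sum>w\<in>pverts G. A_entry \<alpha> G v w * f w) = k * f v)"
      by blast
  next
    assume "\<exists>f. (\<exists>v\<in>pverts G. f v \<noteq> 0) \<and>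
      (\<forall>v\<in>pverts G. (\<Sum>w\<in>pverts G. A_entry \<alpha> G v w * f w) = k * f v)"
    then obtain f u where u: "u \<in> pverts G" "f u \<noteq> 0"
      and f: "\<And>v. v \<in> pverts G \<Longrightarrow> (\<Sum>w\<in>pverts G. A_entry \<alpha> G v w * f w) = k * f v"
      by blast
    define v where "v = vec n (\<lambda>i. f (vs ! i))"
    have v: "v \<in> carrier_vec n" "\<And>j. j < n \<Longrightarrow> v $ j = f (vs ! j)"
      by (auto simp: v_def)
    obtain j where j: "j < n" "u = vs ! j"
      using u(1) unfolding vs(2)[symmetric] in_set_conv_nth vs(3) by blast
    have "v \<noteq> 0\<^sub>v n"
      using v(2)[OF j(1)] j u by auto
    moreover have "A_alpha \<alpha> G *\<^sub>v v = k \<cdot>\<^sub>v v"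
    proof (rule eq_vecI)
      fix i assume "i < dim_vec (k \<cdot>\<^sub>v v)"
      then have i: "i < n" using v by simp
      then have "vs ! i \<in> pverts G" using vs nth_mem by blast
      then show "(A_alpha \<alpha> G *\<^sub>v v) $ i = (k \<cdot>\<^sub>v v) $ i"
        using mult[OF v i] f v i by simp
    qed (use dim v in auto)
    ultimately show "eigenvalue (A_alpha \<alpha> G) k"
      using dim v unfolding eigenvalue_def eigenvector_def by auto
  qed
qed

text \<open>Eigenvalues are roots of the characteristic polynomial, which is monic and hence
  nonzero. Finiteness is what gives the \<open>Max\<close> in \<open>rho_alpha\<close> its
  meaning.\<close>

lemma finite_eigenvalues_A_alpha: "finite {k. eigenvalue (A_alpha \<alpha> G) k}"
proof -
  have dim: "A_alpha \<alpha> G \<in> carrier_mat (card (pverts G)) (card (pverts G))"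
    by (simp add: A_alpha_def degree_matrix_def adjacency_matrix_def Let_def)
  have "char_poly (A_alpha \<alpha> G) \<noteq> 0"
    using degree_monic_char_poly[OF dim] by auto
  then show ?thesis
    using poly_roots_finite by (simp add: eigenvalue_root_char_poly[OF dim])
qed

text \<open>The unit sphere of the real vector space on \<open>V\<close> is modelled by functions on
  the whole type that vanish off \<open>V\<close>, with the product topology. It is a closed subset
  of a product of compact sets, so Tychonoff's theorem applies.\<close>

lemma compact_coordinate_sphere:
  fixes V :: "'a set"
  assumes fin: "finite V"
  shows "compact {g :: 'a \<Rightarrow> real. (\<forall>v. v \<notin> V \<longrightarrow> g v = 0) \<and> (\<Sum>v\<in>V. (g v)\<^sup>2) = 1}"
proof -
  \<comment> \<open>The factor \<open>{0}\<close> pins the coordinates off \<open>V\<close>; on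
    \<open>V\<close> the bound 1 is forced because each square is at most the sum of
    squares.\<close>
  define B where "B = (\<Pi>\<^sub>E v\<in>(UNIV :: 'a set). if v \<in> V then {-1..1 :: real} else {0})"
  have "compactin (product_topology (\<lambda>_. euclidean) UNIV) B"
    unfolding B_def by (subst compactin_PiE) auto
  then have B: "compact B"
    by (simp add: euclidean_product_topology)
  have cont: "continuous_on UNIV (\<lambda>g :: 'a \<Rightarrow> real. \<Sum>v\<in>V. (g v)\<^sup>2)"
    by (intro continuous_intros continuous_on_product_coordinates)
  have "closed ((\<lambda>g :: 'a \<Rightarrow> real. \<Sum>v\<in>V. (g v)\<^sup>2) -` {1})"
    using cont by (intro closed_vimage) auto
  then have "compact (B \<inter> (\<lambda>g :: 'a \<Rightarrow> real. \<Sum>v\<in>V. (g v)\<^sup>2) -` {1})"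
    using B by (rule compact_Int_closed[rotated])
  moreover have "{g :: 'a \<Rightarrow> real. (\<forall>v. v \<notin> V \<longrightarrow> g v = 0) \<and> (\<Sum>v\<in>V. (g v)\<^sup>2) = 1} =
      B \<inter> (\<lambda>g :: 'a \<Rightarrow> real. \<Sum>v\<in>V. (g v)\<^sup>2) -` {1}"
  proof -
    have "\<bar>g v\<bar> \<le> 1" if "(\<Sum>v\<in>V. (g v)\<^sup>2) = 1" "v \<in> V" for g :: "'a \<Rightarrow> real" and v
    proof -
      have "(g v)\<^sup>2 \<le> (\<Sum>v\<in>V. (g v)\<^sup>2)"
        using that fin by (intro member_le_sum) auto
      then show ?thesis
        using that by (simp add: abs_square_le_1)
    qed
    then show ?thesis
      by (fastforce simp: B_def PiE_iff abs_le_iff split: if_splits)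
  qed
  ultimately show ?thesis by simp
qed

text \<open>Rayleigh's argument: the quadratic form attains a maximum on the compact unit sphere. By
  homogeneity this bounds the form everywhere, and at a maximiser the first variation in every
  coordinate direction vanishes, which is the eigenvalue equation.\<close>

lemma symmetric_form_max_eigenvalue:
  fixes M :: "'a \<Rightarrow> 'a \<Rightarrow> real"
  assumes fin: "finite V" and ne: "V \<noteq> {}"
    and sym: "\<And>v w. v \<in> V \<Longrightarrow> w \<in> V \<Longrightarrow> M v w = M w v"
  obtains \<mu> f where "\<exists>v\<in>V. f v \<noteq> 0" "\<And>v. v \<in> V \<Longrightarrow> (\<Sum>w\<in>V. M v w * f w) = \<mu> * f v"
    "\<And>g. (\<Sum>v\<in>V. \<Sum>w\<in>V. M v w * g v * g w) \<le> \<mu> * (\<Sum>v\<in>V. (g v)\<^sup>2)"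
proof -
  define Q where "Q g = (\<Sum>v\<in>V. \<Sum>w\<in>V. M v w * g v * g w)" for g
  define N where "N g = (\<Sum>v\<in>V. (g v)\<^sup>2)" for g :: "'a \<Rightarrow> real"
  define S where "S = {g :: 'a \<Rightarrow> real. (\<forall>v. v \<notin> V \<longrightarrow> g v = 0) \<and> N g = 1}"
  have S: "compact S"
    unfolding S_def N_def by (rule compact_coordinate_sphere[OF fin])
  obtain u where u: "u \<in> V" using ne by blast
  have "N (\<lambda>v. if v = u then 1 else 0) = 1"
    using u fin by (simp add: N_def if_distrib[of "\<lambda>x. x\<^sup>2"] cong: if_cong)
  then have "(\<lambda>v. if v = u then 1 else 0) \<in> S"
    using u by (auto simp: S_def)
  then have "S \<noteq> {}" by blast
  moreover have "continuous_on S Q"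
    unfolding Q_def
    by (intro continuous_intros continuous_on_subset[OF continuous_on_product_coordinates]) auto
  ultimately obtain f where f: "f \<in> S" and max: "\<And>g. g \<in> S \<Longrightarrow> Q g \<le> Q f"
    using continuous_attains_sup[OF S] by blast
  define \<mu> where "\<mu> = Q f"
  have Nf: "N f = 1" using f by (simp add: S_def)
  have le: "Q g \<le> \<mu> * N g" for g
  proof (cases "N g = 0")
    case True
    then have "\<And>v. v \<in> V \<Longrightarrow> g v = 0"
      unfolding N_def using fin by (subst (asm) sum_nonneg_eq_0_iff) auto
    then show ?thesis using True by (simp add: Q_def)
  next
    case False
    have "N g \<ge> 0" by (simp add: N_def sum_nonneg)
    with False have pos: "N g > 0" by simp
    \<comment> \<open>Membership in \<open>S\<close> requires norm 1 and vanishing outside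
      \<open>V\<close>; neither \<open>Q\<close> nor \<open>N\<close> depends on the values outside
      \<open>V\<close>.\<close>
    define h where "h v = (if v \<in> V then g v / sqrt (N g) else 0)" for v
    have "N h = (\<Sum>v\<in>V. (g v)\<^sup>2 / N g)"
      unfolding N_def[of h] using pos by (intro sum.cong) (auto simp: h_def power_divide)
    also have "\<dots> = 1"
      using pos by (simp add: sum_divide_distrib[symmetric] N_def[symmetric])
    finally have "h \<in> S" by (simp add: S_def h_def)
    then have "Q h \<le> \<mu>" using max by (simp add: \<mu>_def)
    moreover have "Q h = Q g / N g"
    proof -
      have "Q h = (\<Sum>v\<in>V. \<Sum>w\<in>V. M v w * g v * g w / N g)"
        unfolding Q_def using pos by (intro sum.cong) (auto simp: h_def)
      then show ?thesis by (simp add: Q_def sum_divide_distrib)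
    qed
    ultimately show ?thesis using pos by (simp add: field_simps)
  qed
  have eig: "(\<Sum>w\<in>V. M x w * f w) = \<mu> * f x" if x: "x \<in> V" for x
  proof -
    \<comment> \<open>The maximiser is perturbed in the direction of the coordinate
      \<open>x\<close>; \<open>c\<close> is the defect in the eigenvalue equation at
      \<open>x\<close>. Symmetry of \<open>M\<close> merges the two cross terms of the perturbed
      form.\<close>
    define e where "e v = (if v = x then 1 else 0 :: real)" for v
    define c where "c = (\<Sum>w\<in>V. M x w * f w) - \<mu> * f x"
    have pick: "(\<Sum>w\<in>V. F w * e w) = F x" for F
    proof -
      have "(\<Sum>w\<in>V. F w * e w) = (\<Sum>w\<in>V. if w = x then F w else 0)"
        by (intro sum.cong) (auto simp: e_def)
      then show ?thesis using x fin by simp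
    qed
    have Qt: "Q (\<lambda>v. f v + t * e v) = \<mu> + 2 * t * (\<Sum>w\<in>V. M x w * f w) + t\<^sup>2 * M x x" for t
    proof -
      have "Q (\<lambda>v. f v + t * e v) = Q f + t * (\<Sum>v\<in>V. \<Sum>w\<in>V. M v w * f v * e w)
          + t * (\<Sum>v\<in>V. \<Sum>w\<in>V. M v w * e v * f w) + t\<^sup>2 * (\<Sum>v\<in>V. \<Sum>w\<in>V. M v w * e v * e w)"
      proof -
        have "M v w * (f v + t * e v) * (f w + t * e w) = M v w * f v * f w +
            t * (M v w * f v * e w) + t * (M v w * e v * f w) + t\<^sup>2 * (M v w * e v * e w)" for v w
          by (simp add: algebra_simps power2_eq_square)
        then show ?thesis
          by (simp only: Q_def sum.distrib sum_distrib_left[symmetric])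
      qed
      moreover have "(\<Sum>v\<in>V. \<Sum>w\<in>V. M v w * f v * e w) = (\<Sum>w\<in>V. M x w * f w)"
        unfolding pick using x sym by (intro sum.cong) auto
      moreover have "(\<Sum>v\<in>V. \<Sum>w\<in>V. M v w * e v * f w) = (\<Sum>w\<in>V. M x w * f w)"
      proof -
        have "M v w * e v * f w = (M v w * f w) * e v" for v w by simp
        then show ?thesis by (subst sum.swap) (simp only: pick)
      qed
      moreover have "(\<Sum>v\<in>V. \<Sum>w\<in>V. M v w * e v * e w) = M x x"
        by (simp only: pick)
      ultimately show ?thesis by (simp add: \<mu>_def algebra_simps)
    qed
    have Nt: "N (\<lambda>v. f v + t * e v) = 1 + 2 * t * f x + t\<^sup>2" for t
    proof -
      have "N (\<lambda>v. f v + t * e v) = N f + 2 * t * (\<Sum>v\<in>V. f v * e v) + t\<^sup>2 * (\<Sum>v\<in>V. e v * e v)"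
      proof -
        have "(f v + t * e v)\<^sup>2 = (f v)\<^sup>2 + 2 * t * (f v * e v) + t\<^sup>2 * (e v * e v)" for v
          by (simp add: algebra_simps power2_eq_square)
        then show ?thesis
          by (simp only: N_def sum.distrib sum_distrib_left[symmetric])
      qed
      then show ?thesis
        unfolding pick Nf by (simp add: e_def)
    qed
    have quad: "2 * t * c + t\<^sup>2 * (M x x - \<mu>) \<le> 0" for t
      using le[of "\<lambda>v. f v + t * e v"] unfolding Qt Nt by (simp add: c_def algebra_simps)
    have "c = 0"
    proof (rule ccontr)
      assume "c \<noteq> 0"
      \<comment> \<open>A linear term with \<open>c \<noteq> 0\<close> beats the quadratic one for
        small \<open>t\<close>. With this \<open>K\<close>, the choice \<open>t = c / K\<close>
        leaves at least \<open>c\<^sup>2 / K\<close>; adding 1 keeps \<open>K\<close>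
        positive.\<close>
      define K where "K = \<bar>M x x - \<mu>\<bar> + 1"
      have K: "K > 0" "M x x - \<mu> \<ge> - K" by (auto simp: K_def)
      have "2 * (c / K) * c + (c / K)\<^sup>2 * (- K) \<le> 2 * (c / K) * c + (c / K)\<^sup>2 * (M x x - \<mu>)"
        using K by (intro add_left_mono mult_left_mono) auto
      also have "\<dots> \<le> 0" by (rule quad)
      finally have "c\<^sup>2 / K \<le> 0"
        using K by (simp add: power2_eq_square field_simps)
      then show False using K \<open>c \<noteq> 0\<close> by (simp add: divide_le_0_iff)
    qed
    then show ?thesis by (simp add: c_def)
  qed
  have "\<exists>v\<in>V. f v \<noteq> 0"
    using Nf by (metis N_def sum.neutral zero_neq_one zero_power2)
  then show ?thesis
    using that eig le unfolding Q_def N_def by blast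
qed

section \<open>Bounds on \<open>rho_alpha\<close> from test vectors\<close>

lemma out_degree_with_proj: "out_degree (with_proj G) v = card {w. (v, w) \<in> parcs G}"
proof -
  have "out_arcs (with_proj G) v = Pair v ` {w. (v, w) \<in> parcs G}"
    by (auto simp: out_arcs_def)
  then show ?thesis
    by (simp add: out_degree_def card_image inj_on_def)
qed

context pair_graph
begin

lemma finite_neighbours: "finite {w. (v, w) \<in> parcs G}"
  by (rule finite_subset[OF _ pair_finite_verts]) (auto dest: in_arcsD2)

lemma sum_A_entry:
  assumes "v \<in> pverts G"
  shows "(\<Sum>w\<in>pverts G. A_entry \<alpha> G v w * f w) =
    \<alpha> * real (out_degree (with_proj G) v) * f v + (1 - \<alpha>) * (\<Sum>w | (v, w) \<in> parcs G. f w)"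
proof -
  have "(\<Sum>w\<in>pverts G. A_entry \<alpha> G v w * f w) =
      (\<Sum>w\<in>pverts G. if v = w then \<alpha> * real (out_degree (with_proj G) v) * f v else 0) +
      (\<Sum>w\<in>pverts G. (1 - \<alpha>) * (if (v, w) \<in> parcs G then f w else 0))"
    unfolding sum.distrib[symmetric] by (intro sum.cong) (auto simp: A_entry_def algebra_simps)
  also have "(\<Sum>w\<in>pverts G. if v = w then \<alpha> * real (out_degree (with_proj G) v) * f v else 0) =
      \<alpha> * real (out_degree (with_proj G) v) * f v"
    using assms pair_finite_verts by simp
  also have "(\<Sum>w\<in>pverts G. (1 - \<alpha>) * (if (v, w) \<in> parcs G then f w else 0)) =
      (1 - \<alpha>) * (\<Sum>w\<in>pverts G. if (v, w) \<in> parcs G then f w else 0)"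
    by (simp add: sum_distrib_left)
  also have "(\<Sum>w\<in>pverts G. if (v, w) \<in> parcs G then f w else 0) = (\<Sum>w | (v, w) \<in> parcs G. f w)"
  proof -
    have "{w \<in> pverts G. (v, w) \<in> parcs G} = {w. (v, w) \<in> parcs G}"
      by (auto dest: in_arcsD2)
    then show ?thesis
      using sum.inter_filter[OF pair_finite_verts, of f "\<lambda>w. (v, w) \<in> parcs G"] by simp
  qed
  finally show ?thesis .
qed

text \<open>The maximum \<open>\<mu>\<close> of the Rayleigh quotient is itself an eigenvalue. So
  the set of eigenvalues is finite and nonempty, its \<open>Max\<close> is attained, and
  \<open>\<mu>\<close> lies below it.\<close>

lemma rho_alpha:
  assumes "pverts G \<noteq> {}"
  shows eigenvalue_rho_alpha: "eigenvalue (A_alpha \<alpha> G) (rho_alpha \<alpha> G)"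
    and A_form_le_rho_alpha: "(\<Sum>v\<in>pverts G. g v * (\<Sum>w\<in>pverts G. A_entry \<alpha> G v w * g w))
      \<le> rho_alpha \<alpha> G * (\<Sum>v\<in>pverts G. (g v)\<^sup>2)"
proof -
  have sym: "A_entry \<alpha> G v w = A_entry \<alpha> G w v" for v w
    using arcs_symmetric by (auto simp: A_entry_def)
  obtain \<mu> f where f: "\<exists>v\<in>pverts G. f v \<noteq> 0"
    "\<And>v. v \<in> pverts G \<Longrightarrow> (\<Sum>w\<in>pverts G. A_entry \<alpha> G v w * f w) = \<mu> * f v"
    and le: "\<And>g. (\<Sum>v\<in>pverts G. \<Sum>w\<in>pverts G. A_entry \<alpha> G v w * g v * g w)
      \<le> \<mu> * (\<Sum>v\<in>pverts G. (g v)\<^sup>2)"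
    by (rule symmetric_form_max_eigenvalue[OF pair_finite_verts assms, of "A_entry \<alpha> G"])
      (use sym in auto)
  have \<mu>: "\<mu> \<in> {k. eigenvalue (A_alpha \<alpha> G) k}"
    using f by (auto simp: eigenvalue_A_alpha_iff[OF pair_finite_verts])
  then show "eigenvalue (A_alpha \<alpha> G) (rho_alpha \<alpha> G)"
    using Max_in[OF finite_eigenvalues_A_alpha, of \<alpha> G] unfolding rho_alpha_def by blast
  have "\<mu> \<le> rho_alpha \<alpha> G"
    using \<mu> finite_eigenvalues_A_alpha unfolding rho_alpha_def by (rule Max_ge[rotated])
  then have "\<mu> * (\<Sum>v\<in>pverts G. (g v)\<^sup>2) \<le> rho_alpha \<alpha> G * (\<Sum>v\<in>pverts G. (g v)\<^sup>2)"
    by (intro mult_right_mono sum_nonneg) auto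
  with le[of g] show "(\<Sum>v\<in>pverts G. g v * (\<Sum>w\<in>pverts G. A_entry \<alpha> G v w * g w))
      \<le> rho_alpha \<alpha> G * (\<Sum>v\<in>pverts G. (g v)\<^sup>2)"
    by (simp add: sum_distrib_left mult_ac)
qed

text \<open>The test vector is 1 at \<open>z\<close>, \<open>b\<close> at its neighbours and 0
  elsewhere. The left-hand side is the form of the bare star at \<open>z\<close>; all further edges
  contribute nonnegatively because \<open>\<alpha>\<close>, \<open>1 - \<alpha>\<close> and
  \<open>b\<close> are nonnegative.\<close>

lemma star_form_le_rho_alpha:
  assumes z: "z \<in> pverts G" and \<alpha>: "0 \<le> \<alpha>" "\<alpha> \<le> 1" and b: "0 \<le> b"
  defines "d \<equiv> real (out_degree (with_proj G) z)"
  shows "\<alpha> * d + d * (\<alpha> * b\<^sup>2 + 2 * (1 - \<alpha>) * b) \<le> rho_alpha \<alpha> G * (1 + d * b\<^sup>2)"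
proof -
  define N where "N = {w. (z, w) \<in> parcs G}"
  define g where "g v = (if v = z then 1 else if v \<in> N then b else 0)" for v
  define h where "h v = g v * (\<Sum>w\<in>pverts G. A_entry \<alpha> G v w * g w)" for v
  have N: "finite N" "N \<subseteq> pverts G" "z \<notin> N" "d = real (card N)"
    using finite_neighbours in_arcsD2 no_loops'[of z z] by (auto simp: N_def d_def out_degree_with_proj)
  have g0: "g v \<ge> 0" for v using b by (simp add: g_def)
  have split: "(\<Sum>v\<in>pverts G. F v) = F z + (\<Sum>v\<in>N. F v)"
    if "\<And>v. v \<in> pverts G \<Longrightarrow> v \<noteq> z \<Longrightarrow> v \<notin> N \<Longrightarrow> F v = 0" for F :: "'a \<Rightarrow> real"
  proof -
    have "(\<Sum>v\<in>pverts G. F v) = (\<Sum>v\<in>insert z N. F v)"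
      using that N z pair_finite_verts by (intro sum.mono_neutral_right) auto
    then show ?thesis using N by simp
  qed
  have gN: "g v = b" if "v \<in> N" for v
    using that N by (auto simp: g_def)
  have hz: "h z = \<alpha> * d + (1 - \<alpha>) * (d * b)"
    using N(4) by (simp add: h_def sum_A_entry[OF z] g_def[of z] N_def[symmetric] gN d_def)
  have hN: "h v \<ge> b * (\<alpha> * b + (1 - \<alpha>))" if v: "v \<in> N" for v
  proof -
    have vz: "z \<in> {w. (v, w) \<in> parcs G}"
      using v arcs_symmetric by (simp add: N_def)
    then have "card {w. (v, w) \<in> parcs G} \<noteq> 0"
      using finite_neighbours by (metis card_0_eq empty_iff)
    then have "1 \<le> real (out_degree (with_proj G) v)"
      by (simp add: out_degree_with_proj)
    then have "\<alpha> * 1 * b \<le> \<alpha> * real (out_degree (with_proj G) v) * b"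
      using \<alpha> b by (intro mult_right_mono mult_left_mono) auto
    moreover have "g z \<le> (\<Sum>w | (v, w) \<in> parcs G. g w)"
      using vz finite_neighbours g0 by (intro member_le_sum) auto
    then have "(1 - \<alpha>) * 1 \<le> (1 - \<alpha>) * (\<Sum>w | (v, w) \<in> parcs G. g w)"
      using \<alpha> by (intro mult_left_mono) (auto simp: g_def[of z])
    ultimately have "\<alpha> * b + (1 - \<alpha>) \<le> (\<Sum>w\<in>pverts G. A_entry \<alpha> G v w * g w)"
      using v N by (subst sum_A_entry) (auto simp: gN)
    then show ?thesis
      using b by (simp add: h_def gN[OF v] mult_left_mono)
  qed
  have "\<alpha> * d + d * (\<alpha> * b\<^sup>2 + 2 * (1 - \<alpha>) * b) = h z + (\<Sum>v\<in>N. b * (\<alpha> * b + (1 - \<alpha>)))"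
    using N(4) by (simp add: hz algebra_simps power2_eq_square)
  also have "\<dots> \<le> h z + (\<Sum>v\<in>N. h v)"
    using hN by (intro add_left_mono sum_mono) auto
  also have "\<dots> = (\<Sum>v\<in>pverts G. h v)"
    by (rule split[symmetric]) (simp add: h_def g_def)
  also have "\<dots> \<le> rho_alpha \<alpha> G * (\<Sum>v\<in>pverts G. (g v)\<^sup>2)"
    unfolding h_def using z by (intro A_form_le_rho_alpha) auto
  also have "(\<Sum>v\<in>pverts G. (g v)\<^sup>2) = 1 + d * b\<^sup>2"
    using N(4) by (subst split) (auto simp: g_def[of z] gN, simp add: g_def)
  finally show ?thesis .
qed

text \<open>The test vector is constantly 1: since \<open>\<alpha> + (1 - \<alpha>) = 1\<close>, the
  row sums of the matrix are the degrees.\<close>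

lemma average_degree_le_rho_alpha:
  assumes "pverts G \<noteq> {}"
  shows "(\<Sum>v\<in>pverts G. real (out_degree (with_proj G) v)) \<le> rho_alpha \<alpha> G * card (pverts G)"
proof -
  have "(\<Sum>w\<in>pverts G. A_entry \<alpha> G v w * 1) = real (out_degree (with_proj G) v)"
    if "v \<in> pverts G" for v
    using sum_A_entry[OF that, of \<alpha> "\<lambda>_. 1"] by (simp add: out_degree_with_proj algebra_simps)
  then show ?thesis
    using A_form_le_rho_alpha[OF assms, of "\<lambda>_. 1" \<alpha>] by simp
qed

end

section \<open>Isomorphism invariance\<close>

text \<open>Arcs are pairs of vertices with tail \<open>fst\<close> and head \<open>snd\<close> on
  both sides, so the arc map of an isomorphism is determined by its vertex map.\<close>

lemma digraph_iso_with_proj_iff: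
  assumes G: "pair_wf_digraph G" and H: "pair_wf_digraph H"
  shows "digraph_iso (with_proj G) (with_proj H) \<longleftrightarrow>
    (\<exists>h. bij_betw h (pverts G) (pverts H) \<and>
      (\<forall>u\<in>pverts G. \<forall>v\<in>pverts G. (u, v) \<in> parcs G \<longleftrightarrow> (h u, h v) \<in> parcs H))"
proof
  interpret G: pair_wf_digraph G by fact
  assume "digraph_iso (with_proj G) (with_proj H)"
  then obtain i where i: "pre_digraph.digraph_isomorphism (with_proj G) i"
    and Hi: "with_proj H = app_iso i (with_proj G)"
    by (auto simp: digraph_iso_def)
  define h where "h = iso_verts i"
  have verts: "pverts H = h ` pverts G"
    using arg_cong[OF Hi, of verts] by (simp add: h_def)
  have arcs: "parcs H = iso_arcs i ` parcs G"
    using arg_cong[OF Hi, of arcs] by simp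
  have "iso_tail i = fst" "iso_head i = snd"
    using arg_cong[OF Hi, of tail] arg_cong[OF Hi, of head] by simp_all
  then have ends: "iso_arcs i e = (h (fst e), h (snd e))" if "e \<in> parcs G" for e
    using i that by (simp add: G.digraph_isomorphism_def h_def prod_eq_iff)
  have inj: "inj_on h (pverts G)"
    using i by (simp add: G.digraph_isomorphism_def h_def)
  have "(u, v) \<in> parcs G \<longleftrightarrow> (h u, h v) \<in> parcs H" if uv: "u \<in> pverts G" "v \<in> pverts G" for u v
  proof
    assume "(u, v) \<in> parcs G"
    then show "(h u, h v) \<in> parcs H"
      using ends[of "(u, v)"] arcs by force
  next
    assume "(h u, h v) \<in> parcs H"
    then obtain e where e: "e \<in> parcs G" "(h u, h v) = iso_arcs i e"
      using arcs by blast
    then have "h u = h (fst e)" "h v = h (snd e)"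
      using ends by auto
    then have "e = (u, v)"
      using inj uv e(1) G.arc_fst_in_verts G.arc_snd_in_verts by (auto simp: prod_eq_iff dest: inj_onD)
    then show "(u, v) \<in> parcs G" using e by simp
  qed
  then show "\<exists>h. bij_betw h (pverts G) (pverts H) \<and>
      (\<forall>u\<in>pverts G. \<forall>v\<in>pverts G. (u, v) \<in> parcs G \<longleftrightarrow> (h u, h v) \<in> parcs H)"
    using inj verts by (auto simp: bij_betw_def)
next
  interpret G: pair_wf_digraph G by fact
  interpret H: pair_wf_digraph H by fact
  assume "\<exists>h. bij_betw h (pverts G) (pverts H) \<and>
      (\<forall>u\<in>pverts G. \<forall>v\<in>pverts G. (u, v) \<in> parcs G \<longleftrightarrow> (h u, h v) \<in> parcs H)"
  then obtain h where inj: "inj_on h (pverts G)" and img: "h ` pverts G = pverts H"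
    and arcs: "\<And>u v. u \<in> pverts G \<Longrightarrow> v \<in> pverts G \<Longrightarrow> (u, v) \<in> parcs G \<longleftrightarrow> (h u, h v) \<in> parcs H"
    by (auto simp: bij_betw_def)
  define i where "i = \<lparr>iso_verts = h, iso_arcs = map_prod h h, iso_head = snd, iso_tail = fst\<rparr>"
  have sub: "parcs G \<subseteq> pverts G \<times> pverts G"
    using G.in_arcsD1 G.in_arcsD2 by auto
  have "inj_on (map_prod h h) (parcs G)"
    using inj_on_subset[OF map_prod_inj_on[OF inj inj] sub] .
  then have "G.digraph_isomorphism i"
    using inj G.wf_digraph_axioms by (auto simp: G.digraph_isomorphism_def i_def)
  moreover have "map_prod h h ` parcs G = parcs H"
  proof
    show "map_prod h h ` parcs G \<subseteq> parcs H"
      using sub arcs by auto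
    show "parcs H \<subseteq> map_prod h h ` parcs G"
    proof
      fix e assume e: "e \<in> parcs H"
      then have "fst e \<in> h ` pverts G" "snd e \<in> h ` pverts G"
        using img H.arc_fst_in_verts H.arc_snd_in_verts by auto
      then obtain u v where "u \<in> pverts G" "v \<in> pverts G" "e = (h u, h v)"
        by (metis imageE prod.collapse)
      then show "e \<in> map_prod h h ` parcs G"
        using arcs e by force
    qed
  qed
  then have "with_proj H = app_iso i (with_proj G)"
    using img by (simp add: with_proj_def app_iso_def i_def)
  ultimately show "digraph_iso (with_proj G) (with_proj H)"
    unfolding digraph_iso_def by blast
qed

lemma out_degree_bij:
  assumes G: "pair_wf_digraph G" and H: "pair_wf_digraph H"
    and h: "bij_betw h (pverts G) (pverts H)"
    and arcs: "\<And>u v. u \<in> pverts G \<Longrightarrow> v \<in> pverts G \<Longrightarrow> (u, v) \<in> parcs G \<longleftrightarrow> (h u, h v) \<in> parcs H"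
    and v: "v \<in> pverts G"
  shows "out_degree (with_proj H) (h v) = out_degree (with_proj G) v"
proof -
  have "{w. (h v, w) \<in> parcs H} = h ` {w. (v, w) \<in> parcs G}"
  proof (intro equalityI subsetI)
    fix w assume w: "w \<in> {w. (h v, w) \<in> parcs H}"
    then have "w \<in> h ` pverts G"
      using h pair_wf_digraph.in_arcsD2[OF H] by (auto simp: bij_betw_def)
    then show "w \<in> h ` {w. (v, w) \<in> parcs G}"
      using arcs[OF v] w by auto
  next
    fix w assume "w \<in> h ` {w. (v, w) \<in> parcs G}"
    then obtain u where u: "(v, u) \<in> parcs G" "w = h u" by blast
    then show "w \<in> {w. (h v, w) \<in> parcs H}"
      using arcs[OF v pair_wf_digraph.in_arcsD2[OF G u(1)]] by simp
  qed
  moreover have "inj_on h {w. (v, w) \<in> parcs G}"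
    by (rule inj_on_subset[OF bij_betw_imp_inj_on[OF h]])
      (blast intro: pair_wf_digraph.in_arcsD2[OF G])
  ultimately show ?thesis by (simp add: out_degree_with_proj card_image)
qed

lemma max_degree_iso:
  assumes G: "pair_wf_digraph G" and H: "pair_wf_digraph H"
    and iso: "digraph_iso (with_proj G) (with_proj H)"
  shows "max_degree G = max_degree H"
proof -
  obtain h where h: "bij_betw h (pverts G) (pverts H)"
    and arcs: "\<And>u v. u \<in> pverts G \<Longrightarrow> v \<in> pverts G \<Longrightarrow> (u, v) \<in> parcs G \<longleftrightarrow> (h u, h v) \<in> parcs H"
    using iso unfolding digraph_iso_with_proj_iff[OF G H] by blast
  have "out_degree (with_proj H) ` pverts H = out_degree (with_proj G) ` pverts G"
    using out_degree_bij[OF G H h arcs] unfolding bij_betw_imp_surj_on[OF h, symmetric] image_image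
    by (intro image_cong) auto
  then show ?thesis by (simp add: max_degree_def)
qed

text \<open>An eigenvector of \<open>H\<close> is pulled back along the vertex bijection. One
  inclusion suffices, as the other follows from the inverse isomorphism.\<close>

lemma eigenvalue_A_alpha_iso:
  assumes G: "pair_wf_digraph G" "finite (pverts G)" and H: "pair_wf_digraph H" "finite (pverts H)"
    and iso: "digraph_iso (with_proj G) (with_proj H)" and ev: "eigenvalue (A_alpha \<alpha> H) k"
  shows "eigenvalue (A_alpha \<alpha> G) k"
proof -
  obtain h where h: "bij_betw h (pverts G) (pverts H)"
    and arcs: "\<And>u v. u \<in> pverts G \<Longrightarrow> v \<in> pverts G \<Longrightarrow> (u, v) \<in> parcs G \<longleftrightarrow> (h u, h v) \<in> parcs H"
    using iso unfolding digraph_iso_with_proj_iff[OF G(1) H(1)] by blast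
  note deg = out_degree_bij[OF G(1) H(1) h arcs]
  have ent: "A_entry \<alpha> G v w = A_entry \<alpha> H (h v) (h w)" if "v \<in> pverts G" "w \<in> pverts G" for v w
    using that inj_on_eq_iff[of h "pverts G" v w] h
    by (simp add: A_entry_def bij_betw_def deg arcs)
  obtain f where f: "\<exists>v\<in>pverts H. f v \<noteq> 0"
    "\<And>v. v \<in> pverts H \<Longrightarrow> (\<Sum>w\<in>pverts H. A_entry \<alpha> H v w * f w) = k * f v"
    using ev unfolding eigenvalue_A_alpha_iff[OF H(2)] by blast
  have "(\<Sum>w\<in>pverts G. A_entry \<alpha> G v w * f (h w)) = k * f (h v)" if v: "v \<in> pverts G" for v
  proof -
    have "(\<Sum>w\<in>pverts G. A_entry \<alpha> G v w * f (h w)) =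
        (\<Sum>w\<in>pverts G. A_entry \<alpha> H (h v) (h w) * f (h w))"
      using ent v by (intro sum.cong) auto
    also have "\<dots> = (\<Sum>w\<in>pverts H. A_entry \<alpha> H (h v) w * f w)"
      by (rule sum.reindex_bij_betw[OF h])
    also have "\<dots> = k * f (h v)"
      using f(2) h v by (auto simp: bij_betw_def)
    finally show ?thesis .
  qed
  moreover have "\<exists>v\<in>pverts G. f (h v) \<noteq> 0"
    using f(1) unfolding bij_betw_imp_surj_on[OF h, symmetric] by simp
  ultimately show ?thesis
    unfolding eigenvalue_A_alpha_iff[OF G(2)] by (intro exI[of _ "\<lambda>v. f (h v)"] conjI ballI)
qed

lemma rho_alpha_iso:
  assumes G: "pair_wf_digraph G" "finite (pverts G)" and H: "pair_wf_digraph H" "finite (pverts H)"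
    and iso: "digraph_iso (with_proj G) (with_proj H)"
  shows "rho_alpha \<alpha> G = rho_alpha \<alpha> H"
proof -
  have "wf_digraph (with_proj G)"
    using G(1) by (simp add: wf_digraph_wp_iff)
  then have "digraph_iso (with_proj H) (with_proj G)"
    using iso by (rule digraph_iso_swap)
  then have "eigenvalue (A_alpha \<alpha> G) = eigenvalue (A_alpha \<alpha> H)"
    using eigenvalue_A_alpha_iso[OF G H iso] eigenvalue_A_alpha_iso[OF H G] by blast
  then show ?thesis by (simp add: rho_alpha_def)
qed

section \<open>The star with an additional edge\<close>

lemma pair_graph_star_plus_edge:
  assumes "n \<ge> 3"
  shows "pair_graph (star_plus_edge n)"
proof unfold_locales
  show "finite (parcs (star_plus_edge n))"
    by (simp add: star_plus_edge_def star_graph_def)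
  show "symmetric (with_proj (star_plus_edge n))"
    by (auto simp: symmetric_def sym_def star_plus_edge_def star_graph_def)
qed (use assms in \<open>auto simp: star_plus_edge_def star_graph_def\<close>)

lemma neighbours_star_plus_edge:
  assumes "n \<ge> 3"
  shows "{w. (0, w) \<in> parcs (star_plus_edge n)} = {1..<n}"
    and "{w. (1, w) \<in> parcs (star_plus_edge n)} = {0, 2}"
    and "{w. (2, w) \<in> parcs (star_plus_edge n)} = {0, 1}"
    and "\<And>i. i \<in> {3..<n} \<Longrightarrow> {w. (i, w) \<in> parcs (star_plus_edge n)} = {0}"
  using assms by (auto simp: star_plus_edge_def star_graph_def)

lemma atLeast0_lessThan_split:
  "n \<ge> 3 \<Longrightarrow> {0..<n} = insert 0 (insert 1 (insert 2 {3..<n}))" for n :: nat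
  by auto

text \<open>The graph has as many edges as vertices, hence average degree 2. For
  \<open>\<alpha> < 1\<close> this bound makes the denominators \<open>r - \<alpha> - 1\<close> and
  \<open>r - \<alpha>\<close> in the equation for \<open>r\<close> positive.\<close>

lemma rho_alpha_star_plus_edge_ge_2:
  assumes n: "n \<ge> 3"
  shows "rho_alpha \<alpha> (star_plus_edge n) \<ge> 2"
proof -
  interpret pair_graph "star_plus_edge n" using n by (rule pair_graph_star_plus_edge)
  have V: "pverts (star_plus_edge n) = {0..<n}"
    by (simp add: star_plus_edge_def star_graph_def)
  let ?d = "\<lambda>v. real (out_degree (with_proj (star_plus_edge n)) v)"
  have d: "?d 0 = real (n - 1)" "?d 1 = 2" "?d 2 = 2" "\<And>i. i \<in> {3..<n} \<Longrightarrow> ?d i = 1"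
    using neighbours_star_plus_edge[OF n] by (simp_all add: out_degree_with_proj)
  have "(\<Sum>v\<in>{0..<n}. ?d v) = ?d 0 + (?d 1 + (?d 2 + (\<Sum>v\<in>{3..<n}. ?d v)))"
    unfolding atLeast0_lessThan_split[OF n] by simp
  also have "\<dots> = 2 * real n"
    using n by (simp add: d of_nat_diff del: One_nat_def)
  finally have "2 * real n \<le> rho_alpha \<alpha> (star_plus_edge n) * real n"
    using average_degree_le_rho_alpha[of \<alpha>] n by (simp add: V)
  then show ?thesis using n by simp
qed

text \<open>The rows of the non-central vertices express every entry of an eigenvector through the
  entry at the centre 0; substituting them into the row of the centre and cancelling that entry
  gives the equation.\<close>

lemma rho_alpha_star_plus_edge_eq:
  assumes n: "n \<ge> 3" and \<alpha>: "0 \<le> \<alpha>" "\<alpha> < 1"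
  defines "r \<equiv> rho_alpha \<alpha> (star_plus_edge n)"
  shows "r - \<alpha> * (real n - 1) = (1 - \<alpha>)\<^sup>2 * (2 / (r - \<alpha> - 1) + (real n - 3) / (r - \<alpha>))"
proof -
  interpret pair_graph "star_plus_edge n" using n by (rule pair_graph_star_plus_edge)
  have V: "pverts (star_plus_edge n) = {0..<n}"
    by (simp add: star_plus_edge_def star_graph_def)
  have r2: "r \<ge> 2"
    unfolding r_def using n by (rule rho_alpha_star_plus_edge_ge_2)
  note N = neighbours_star_plus_edge[OF n]
  have "eigenvalue (A_alpha \<alpha> (star_plus_edge n)) r"
    unfolding r_def using n by (intro eigenvalue_rho_alpha) (simp add: V)
  then obtain f where f0: "\<exists>v\<in>{0..<n}. f v \<noteq> 0"
    and f: "\<And>v. v \<in> {0..<n} \<Longrightarrow>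
      \<alpha> * real (card {w. (v, w) \<in> parcs (star_plus_edge n)}) * f v +
      (1 - \<alpha>) * (\<Sum>w | (v, w) \<in> parcs (star_plus_edge n). f w) = r * f v"
    using sum_A_entry[of _ \<alpha>]
    unfolding eigenvalue_A_alpha_iff[OF pair_finite_verts] V out_degree_with_proj by force
  have e1: "\<alpha> * 2 * f 1 + (1 - \<alpha>) * (f 0 + f 2) = r * f 1"
    using f[of 1] n unfolding N(2) by simp
  have e2: "\<alpha> * 2 * f 2 + (1 - \<alpha>) * (f 0 + f 1) = r * f 2"
    using f[of 2] n unfolding N(3) by simp
  have e3: "\<alpha> * f i + (1 - \<alpha>) * f 0 = r * f i" if "i \<in> {3..<n}" for i
    using f[of i] that unfolding N(4)[OF that] by simp
  \<comment> \<open>Subtracting the rows of 1 and 2 leaves a factor that is positive because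
    \<open>r \<ge> 2\<close> and \<open>\<alpha> < 1\<close>, so the eigenvector is symmetric in
    these two vertices.\<close>
  have "(r - 2 * \<alpha> + (1 - \<alpha>)) * (f 1 - f 2) = 0"
    using e1 e2 by (simp add: algebra_simps)
  then have f12: "f 2 = f 1"
    using r2 \<alpha> by simp
  have f1: "f 1 = (1 - \<alpha>) * f 0 / (r - \<alpha> - 1)"
    using e1 r2 \<alpha> unfolding f12 by (simp add: field_simps)
  have f3: "f i = (1 - \<alpha>) * f 0 / (r - \<alpha>)" if "i \<in> {3..<n}" for i
    using e3[OF that] r2 \<alpha> by (simp add: field_simps)
  have "f 0 \<noteq> 0"
  proof
    assume "f 0 = 0"
    then have "\<forall>v\<in>{0..<n}. f v = 0"
      using f1 f12 f3 unfolding atLeast0_lessThan_split[OF n] by simp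
    then show False using f0 by blast
  qed
  define K where "K = 2 / (r - \<alpha> - 1) + (real n - 3) / (r - \<alpha>)"
  have "{1..<n} = insert 1 (insert 2 {3..<n})"
    using n by auto
  then have "(\<Sum>w\<in>{1..<n}. f w) = f 1 + (f 2 + (\<Sum>w\<in>{3..<n}. f w))"
    by simp
  also have "(\<Sum>w\<in>{3..<n}. f w) = (real n - 3) * ((1 - \<alpha>) * f 0 / (r - \<alpha>))"
    using n f3 by (simp add: of_nat_diff)
  finally have sum: "(\<Sum>w\<in>{1..<n}. f w) = (1 - \<alpha>) * f 0 * K"
    unfolding f12 f1 K_def by (simp add: algebra_simps)
  have "\<alpha> * (real n - 1) * f 0 + (1 - \<alpha>) * (\<Sum>w\<in>{1..<n}. f w) = r * f 0"
    using f[of 0] n unfolding N(1) by (simp add: of_nat_diff)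
  then have "(r - \<alpha> * (real n - 1)) * f 0 = ((1 - \<alpha>)\<^sup>2 * K) * f 0"
    unfolding sum by (simp add: algebra_simps power2_eq_square)
  then show ?thesis using \<open>f 0 \<noteq> 0\<close> by (simp add: K_def)
qed

lemma max_degree_star_plus_edge:
  assumes n: "n \<ge> 3"
  shows "max_degree (star_plus_edge n) = n - 1"
proof -
  have "out_degree (with_proj (star_plus_edge n)) v \<le> n - 1" if "v \<in> {0..<n}" for v
    using that n neighbours_star_plus_edge[OF n] unfolding atLeast0_lessThan_split[OF n]
    by (auto simp: out_degree_with_proj simp del: One_nat_def)
  moreover have "out_degree (with_proj (star_plus_edge n)) 0 = n - 1"
    using neighbours_star_plus_edge(1)[OF n] by (simp add: out_degree_with_proj)
  ultimately show ?thesis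
    unfolding max_degree_def using n
    by (intro Max_eqI) (auto simp: star_plus_edge_def star_graph_def intro!: rev_image_eqI[of 0])
qed

text \<open>
  With \<open>\<beta> = 1 - \<alpha>\<close>, \<open>X = r - \<alpha>\<close>, \<open>s = m - X\<close> and \<open>Y = \<kappa> - \<alpha> = d - s\<close>, minus the left-hand side is
  \<open>\<beta> Y + \<alpha> - \<alpha> s - \<beta>\<^sup>2 - \<beta>\<^sup>2 s / Y\<close>, which is increasing in \<open>Y\<close> because \<open>s \<ge> 0\<close>. This reduces the claim to
  \<open>d = m - 1\<close>, i.e. \<open>Y = X - 1\<close>, where the equation for \<open>r\<close> turns it into \<open>\<beta> (2 - s) < X (X - 1)\<close>.
\<close>
lemma star_gap_pos:
  fixes \<alpha> r m d :: real
  assumes \<alpha>: "0 \<le> \<alpha>" "\<alpha> < 1" and m: "m \<ge> 3" and r: "r \<ge> 2"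
    and eq: "r - \<alpha> * m = (1 - \<alpha>)\<^sup>2 * (2 / (r - \<alpha> - 1) + (m - 2) / (r - \<alpha>))"
    and d: "d \<le> m - 1" and \<kappa>: "\<kappa> = d - (m - r)" "\<alpha> < \<kappa>"
  shows "\<alpha> * d - \<kappa> + d * (1 - \<alpha>)\<^sup>2 / (\<kappa> - \<alpha>) > 0"
proof -
  define \<beta> X s Y where "\<beta> = 1 - \<alpha>" and "X = r - \<alpha>" and "s = m - X" and "Y = \<kappa> - \<alpha>"
  have \<beta>: "0 < \<beta>" "\<beta> \<le> 1" using \<alpha> by (auto simp: \<beta>_def)
  have X: "X - 1 \<ge> \<beta>" "X - 1 > 0" "X > 0" using r \<alpha> \<beta> by (auto simp: X_def \<beta>_def)
  have Y: "0 < Y" "Y \<le> X - 1" "d = Y + s"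
    using \<kappa> d by (auto simp: Y_def X_def s_def)
  have \<alpha>': "\<alpha> = 1 - \<beta>" by (simp add: \<beta>_def)
  have eqX: "X + \<alpha> - \<alpha> * m = \<beta>\<^sup>2 * (2 / (X - 1) + (m - 2) / X)"
    using eq by (simp add: X_def \<beta>_def)
  \<comment> \<open>If \<open>X\<close> exceeded \<open>m\<close>, both fractions in
    \<open>eqX\<close> would be at most 1 and its right-hand side at most
    \<open>2 * \<beta> \<le> \<beta> * (m - 1)\<close>, which is less than its left-hand
    side.\<close>
  have s: "s \<ge> 0"
  proof (rule ccontr)
    assume "\<not> s \<ge> 0"
    then have mX: "X > m" by (simp add: s_def)
    have "2 / (X - 1) \<le> 1" "(m - 2) / X \<le> 1"
      using mX m by (auto simp: field_simps)
    then have "\<beta>\<^sup>2 * (2 / (X - 1) + (m - 2) / X) \<le> \<beta>\<^sup>2 * 2"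
      by (intro mult_left_mono) auto
    also have "\<dots> \<le> \<beta> * 2"
      using \<beta> by (simp add: power2_eq_square)
    also have "\<dots> \<le> \<beta> * (m - 1)"
      using \<beta> m by (intro mult_left_mono) auto
    also have "\<dots> < X + \<alpha> - \<alpha> * m"
      using mX by (simp add: \<alpha>' algebra_simps)
    finally show False using eqX by simp
  qed
  \<comment> \<open>Here \<open>2 - s = X - (m - 2) < X\<close>, and
    \<open>\<beta> \<le> X - 1\<close> is a restatement of \<open>r \<ge> 2\<close>.\<close>
  have key: "\<beta> * (2 - s) < X * (X - 1)"
  proof -
    have "\<beta> * (2 - s) < \<beta> * X"
      using m \<beta> by (intro mult_strict_left_mono) (auto simp: s_def)
    also have "\<dots> \<le> X * (X - 1)"
      using X by (simp add: mult.commute mult_left_mono)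
    finally show ?thesis .
  qed
  have "s / (X - 1) \<le> s / Y"
    using s Y X by (intro divide_left_mono) auto
  then have sY: "\<beta>\<^sup>2 * (s / (X - 1)) \<le> \<beta>\<^sup>2 * (s / Y)"
    by (intro mult_left_mono) auto
  have bY: "\<beta> * Y \<le> \<beta> * (X - 1)"
    using Y \<beta> by (intro mult_left_mono) auto
  have eqs: "\<beta> * X + \<alpha> - \<alpha> * s = \<beta>\<^sup>2 * (2 / (X - 1) + 1 + (s - 2) / X)"
  proof -
    have "m = X + s" by (simp add: s_def)
    then have "X + \<alpha> - \<alpha> * (X + s) = \<beta>\<^sup>2 * (2 / (X - 1) + (X + (s - 2)) / X)"
      using eqX by (simp add: algebra_simps)
    moreover have "(X + (s - 2)) / X = 1 + (s - 2) / X"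
      using X by (simp add: field_simps)
    ultimately have "X + \<alpha> - \<alpha> * (X + s) = \<beta>\<^sup>2 * (2 / (X - 1) + 1 + (s - 2) / X)"
      by (simp only: add.assoc)
    moreover have "X + \<alpha> - \<alpha> * (X + s) = \<beta> * X + \<alpha> - \<alpha> * s"
      by (simp add: \<alpha>' algebra_simps)
    ultimately show ?thesis by (simp only:)
  qed
  have "(2 - s) / (X - 1) + (s - 2) / X = (2 - s) / (X * (X - 1))"
    using X by (simp add: divide_simps) (simp add: algebra_simps)
  then have "\<beta>\<^sup>2 * ((2 - s) / (X - 1) + (s - 2) / X) = \<beta> * ((\<beta> * (2 - s)) / (X * (X - 1)))"
    by (simp add: power2_eq_square)
  also have "\<dots> < \<beta> * 1"
    using key X \<beta> by (intro mult_strict_left_mono) auto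
  finally have fin: "\<beta>\<^sup>2 * (2 / (X - 1) + (s - 2) / X) - \<beta>\<^sup>2 * (s / (X - 1)) < \<beta>"
    by (simp add: diff_divide_distrib algebra_simps)
  \<comment> \<open>\<open>bY\<close> and \<open>sY\<close> replace \<open>Y\<close> by
    \<open>X - 1\<close>, \<open>eqs\<close> then eliminates
    \<open>\<beta> * X + \<alpha> - \<alpha> * s\<close>, and what remains is
    \<open>fin\<close>.\<close>
  have "\<beta> * Y + \<alpha> - \<alpha> * s - \<beta>\<^sup>2 - \<beta>\<^sup>2 * (s / Y) < 0"
    using fin eqs sY bY by (simp add: algebra_simps)
  moreover have "d * \<beta>\<^sup>2 / Y = \<beta>\<^sup>2 + \<beta>\<^sup>2 * (s / Y)"
    using Y by (simp add: field_simps)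
  moreover have "\<kappa> = Y + \<alpha>" by (simp add: Y_def)
  ultimately show ?thesis
    unfolding \<beta>_def[symmetric] Y_def[symmetric] using Y(3) by (simp add: \<alpha>' algebra_simps)
qed

lemma (in pair_graph) gamma_alpha_less_star_plus_edge:
  assumes n: "card (pverts G) = n" "n \<ge> 4" and \<alpha>: "0 \<le> \<alpha>" "\<alpha> < 1"
    and deg: "1 \<le> max_degree G" "max_degree G < n - 1"
  shows "gamma_alpha \<alpha> G < gamma_alpha \<alpha> (star_plus_edge n)"
proof -
  define r where "r = rho_alpha \<alpha> (star_plus_edge n)"
  define m where "m = real n - 1"
  define \<rho> where "\<rho> = rho_alpha \<alpha> G"
  have m: "m \<ge> 3" "real (n - 1) = m" using n by (auto simp: m_def of_nat_diff)
  have ne: "pverts G \<noteq> {}" using n by auto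
  obtain z where z: "z \<in> pverts G" "out_degree (with_proj G) z = max_degree G"
    using Max_in[of "out_degree (with_proj G) ` pverts G"] ne pair_finite_verts
    unfolding max_degree_def by fastforce
  define d where "d = real (max_degree G)"
  have d: "1 \<le> d" "d \<le> m - 1" using deg n by (auto simp: d_def m_def)
  \<comment> \<open>\<open>\<kappa>\<close> is the value of \<open>\<rho>\<close> at which the two
    gaps would coincide, so the claim amounts to \<open>\<kappa> < \<rho>\<close>.\<close>
  define \<kappa> where "\<kappa> = d - (m - r)"
  have star: "\<alpha> * d + d * (\<alpha> * b\<^sup>2 + 2 * (1 - \<alpha>) * b) \<le> \<rho> * (1 + d * b\<^sup>2)" if "b \<ge> 0" for b
    using star_form_le_rho_alpha[OF z(1), of \<alpha> b] \<alpha> that z(2) by (simp add: d_def \<rho>_def)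
  have "\<kappa> < \<rho>"
  proof (cases "\<alpha> < \<kappa>")
    case True
    \<comment> \<open>This \<open>b\<close> solves
      \<open>\<alpha> * b + (1 - \<alpha>) = \<kappa> * b\<close>, the eigenvalue equation for
      \<open>\<kappa>\<close> at a leaf of the star. The form minus \<open>\<kappa>\<close> times
      the squared norm is then the defect at the centre alone, which \<open>star_gap_pos\<close>
      shows to be positive.\<close>
    define b where "b = (1 - \<alpha>) / (\<kappa> - \<alpha>)"
    have b: "b \<ge> 0" "(1 - \<alpha>) = b * (\<kappa> - \<alpha>)" using True \<alpha> by (auto simp: b_def)
    have "r - \<alpha> * m = (1 - \<alpha>)\<^sup>2 * (2 / (r - \<alpha> - 1) + (m - 2) / (r - \<alpha>))"
      using rho_alpha_star_plus_edge_eq[of n \<alpha>] n \<alpha> by (simp add: r_def m_def)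
    then have "\<alpha> * d - \<kappa> + d * (1 - \<alpha>)\<^sup>2 / (\<kappa> - \<alpha>) > 0"
      using rho_alpha_star_plus_edge_ge_2[of n \<alpha>] n \<alpha> m(1) d(2) True
      by (intro star_gap_pos[of \<alpha> m r d]) (auto simp: r_def \<kappa>_def)
    moreover have "(1 - \<alpha>)\<^sup>2 / (\<kappa> - \<alpha>) = b\<^sup>2 * (\<kappa> - \<alpha>)"
      unfolding b(2) using True by (simp add: power2_eq_square)
    ultimately have "\<alpha> * d - \<kappa> + d * (b\<^sup>2 * (\<kappa> - \<alpha>)) > 0"
      by (metis times_divide_eq_right)
    then have "\<kappa> * (1 + d * b\<^sup>2) < \<alpha> * d + d * (\<alpha> * b\<^sup>2 + 2 * (b * (\<kappa> - \<alpha>)) * b)"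
      by (simp add: algebra_simps power2_eq_square)
    also have "\<dots> \<le> \<rho> * (1 + d * b\<^sup>2)"
      using star[OF b(1)] unfolding b(2)[symmetric] .
    finally show ?thesis
      using d by (intro mult_right_less_imp_less[of \<kappa> "1 + d * b\<^sup>2" \<rho>]) auto
  next
    case False
    \<comment> \<open>Here \<open>\<kappa> \<le> \<alpha>\<close>, so it is enough that the test
      vector with \<open>b = 1\<close> has Rayleigh quotient above \<open>\<alpha>\<close>.\<close>
    have "\<alpha> * (1 + d) < \<alpha> * d + d * (\<alpha> + 2 * (1 - \<alpha>))"
    proof -
      have "\<alpha> * 1 \<le> \<alpha> * d" "0 < d * (1 - \<alpha>)"
        using \<alpha> d by (intro mult_left_mono mult_pos_pos; simp)+
      then show ?thesis by (simp add: algebra_simps)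
    qed
    also have "\<dots> \<le> \<rho> * (1 + d)"
      using star[of 1] by simp
    finally have "\<alpha> < \<rho>" using d by simp
    then show ?thesis using False by simp
  qed
  then show ?thesis
    using n m by (simp add: gamma_alpha_def max_degree_star_plus_edge \<kappa>_def d_def r_def \<rho>_def)
qed

section \<open>Unicyclic graphs with a dominating vertex\<close>

text \<open>On a cycle, \<open>z\<close> is the tail of at most one arc and the head of at most one,
  so among three or more arcs some arc misses it.\<close>

lemma (in pair_graph) obtain_cycle_arc_avoiding:
  assumes cyc: "cycle p" and len: "3 \<le> length p"
  obtains x y where "(x, y) \<in> parcs G" "x \<noteq> z" "y \<noteq> z"
proof -
  obtain u where u: "awalk u p u" "distinct (tl (pawalk_verts u p))" "distinct p" "p \<noteq> []"
    using cyc unfolding cycle_conv by auto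
  have cas: "pcas u p u" and arcs: "set p \<subseteq> parcs G"
    using u(1) by (auto simp: awalk_def)
  have heads: "pawalk_verts u p = fst (hd p) # map snd p"
    using awalk_verts_conv'[OF cas] u(4) by simp
  have tails: "pawalk_verts u p = map fst p @ [snd (last p)]"
    using awalk_verts_conv[of u p] u(4) by simp
  have "distinct (map snd p)"
    using u(2) heads by simp
  \<comment> \<open>The walk is closed, so the list of tails is the list of heads rotated by one
    place.\<close>
  moreover have "distinct (map fst p)"
  proof -
    have "snd (last p) = fst (hd p)"
      using awlast_if_cas[OF cas] tails cas u(4) by (cases p) auto
    then have "map fst p = last (map snd p) # butlast (map snd p)"
      using arg_cong[OF trans[OF tails[symmetric] heads], of butlast] u(4)
      by (simp add: last_map)
    moreover have "distinct (butlast (map snd p) @ [last (map snd p)])"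
      using \<open>distinct (map snd p)\<close> u(4) by simp
    ultimately show ?thesis
      by simp
  qed
  ultimately have inj: "inj_on snd (set p)" "inj_on fst (set p)"
    by (auto simp: distinct_map)
  have card1: "card {e \<in> set p. g e = z} \<le> 1" if "inj_on g (set p)" for g :: "'a \<times> 'a \<Rightarrow> 'a"
    using that by (intro card_le_Suc0_iff_eq[THEN iffD2, folded One_nat_def]) (auto dest: inj_onD)
  have "card ({e \<in> set p. fst e = z} \<union> {e \<in> set p. snd e = z}) \<le> 2"
    using card_Un_le[of "{e \<in> set p. fst e = z}" "{e \<in> set p. snd e = z}"]
      card1[OF inj(1)] card1[OF inj(2)] by linarith
  moreover have "card (set p) \<ge> 3"
    using len u(3) by (simp add: distinct_card)
  ultimately have "set p \<noteq> {e \<in> set p. fst e = z} \<union> {e \<in> set p. snd e = z}"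
    by fastforce
  then obtain e where "e \<in> set p" "fst e \<noteq> z" "snd e \<noteq> z"
    by blast
  then show ?thesis
    using that[of "fst e" "snd e"] arcs by auto
qed

lemma (in pair_graph) triangle_in_undirected_cycles:
  assumes "(z, x) \<in> parcs G" "(x, y) \<in> parcs G" "(y, z) \<in> parcs G"
  shows "{{z, x}, {x, y}, {y, z}} \<in> undirected_cycles G"
proof -
  have "x \<noteq> z" "x \<noteq> y" "y \<noteq> z"
    using assms no_loops' by auto
  then have "cycle [(z, x), (x, y), (y, z)]"
    using assms in_arcsD1 in_arcsD2 by (auto simp: cycle_def awalk_def intro!: exI[of _ z])
  then show ?thesis
    unfolding undirected_cycles_def by (force intro!: exI[of _ "[(z, x), (x, y), (y, z)]"])
qed

text \<open>The cycle supplies an edge avoiding \<open>z\<close>. Each such edge spans a triangle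
  with \<open>z\<close>, and uniqueness of the cycle identifies all these triangles, so there is
  exactly one such edge besides the star at \<open>z\<close>.\<close>

lemma unicyclic_dominating_vertex_iso:
  assumes uni: "unicyclic G" and n: "card (pverts G) = n"
    and z: "z \<in> pverts G" "out_degree (with_proj G) z = n - 1"
  shows "digraph_iso (with_proj G) (with_proj (star_plus_edge n))"
proof -
  interpret pair_graph G using uni by (simp add: unicyclic_def)
  obtain C where C: "C \<in> undirected_cycles G" and C_unique: "\<And>D. D \<in> undirected_cycles G \<Longrightarrow> D = C"
    using uni by (auto simp: unicyclic_def)
  have "{w. (z, w) \<in> parcs G} = pverts G - {z}"
    using z n in_arcsD2 no_loops'[of z z] pair_finite_verts
    by (intro card_subset_eq) (auto simp: out_degree_with_proj)
  then have star_out: "(z, w) \<in> parcs G \<longleftrightarrow> w \<in> pverts G \<and> w \<noteq> z" for w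
    by auto
  have star_in: "(w, z) \<in> parcs G \<longleftrightarrow> w \<in> pverts G \<and> w \<noteq> z" for w
    using star_out[of w] arcs_symmetric[of w z] arcs_symmetric[of z w] by blast
  obtain p where "cycle p" "3 \<le> length p"
    using C by (auto simp: undirected_cycles_def)
  then obtain x y where xy: "(x, y) \<in> parcs G" "x \<noteq> z" "y \<noteq> z"
    by (rule obtain_cycle_arc_avoiding)
  have tri: "{{z, u}, {u, v}, {v, z}} = C" if "(u, v) \<in> parcs G" "u \<noteq> z" "v \<noteq> z" for u v
    using that in_arcsD1[OF that(1)] in_arcsD2[OF that(1)]
    by (intro C_unique triangle_in_undirected_cycles) (simp_all add: star_out star_in)
  \<comment> \<open>In each triangle the edge opposite \<open>z\<close> is the only one not
    containing \<open>z\<close>, so equal triangles have equal opposite edges.\<close>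
  have only: "{u, v} = {x, y}" if uv: "(u, v) \<in> parcs G" "u \<noteq> z" "v \<noteq> z" for u v
  proof -
    have "{u, v} \<in> {{z, x}, {x, y}, {y, z}}"
      unfolding tri[OF xy] tri[OF uv, symmetric] by simp
    moreover have "{u, v} \<noteq> {z, x}" "{u, v} \<noteq> {y, z}"
      using uv by (simp_all add: doubleton_eq_iff)
    ultimately show ?thesis by simp
  qed
  have xyV: "x \<in> pverts G" "y \<in> pverts G" "x \<noteq> y" "(y, x) \<in> parcs G"
    using in_arcsD1[OF xy(1)] in_arcsD2[OF xy(1)] no_loops'[OF xy(1)] arcs_symmetric[OF xy(1)] by auto
  have "card {z, x, y} \<le> card (pverts G)"
    using z xyV pair_finite_verts by (intro card_mono) auto
  then have n3: "n \<ge> 3" using n xy xyV by simp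
  define R where "R = pverts G - {z, x, y}"
  have "card R = n - 3"
    using n xy xyV z unfolding R_def by (subst card_Diff_subset) auto
  then obtain h where h: "bij_betw h R {3..<n}"
    using finite_same_card_bij[of R "{3..<n}"] pair_finite_verts by (auto simp: R_def)
  \<comment> \<open>The vertices in \<open>R\<close> are adjacent to \<open>z\<close> only, so any
    bijection \<open>h\<close> onto the remaining leaves will do.\<close>
  define k where "k v = (if v = z then 0 else if v = x then 1 else if v = y then 2 else h v)" for v
  have kR: "k v = h v" if "v \<in> R" for v
    using that by (auto simp: k_def R_def)
  have kzxy: "k z = 0" "k x = 1" "k y = 2"
    using xy xyV by (auto simp: k_def)
  have V: "pverts G = insert z (insert x (insert y R))"
    using z xyV by (auto simp: R_def)
  have "bij_betw k R {3..<n}"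
    using h kR by (simp cong: bij_betw_cong)
  then have img: "k ` pverts G = {0..<n}"
    unfolding V atLeast0_lessThan_split[OF n3] by (simp add: kzxy bij_betw_imp_surj_on)
  \<comment> \<open>Both sets have \<open>n\<close> elements, so surjectivity gives
    injectivity.\<close>
  then have inj: "inj_on k (pverts G)"
    using n pair_finite_verts by (intro eq_card_imp_inj_on) simp_all
  with img have bij: "bij_betw k (pverts G) (pverts (star_plus_edge n))"
    by (simp add: bij_betw_def star_plus_edge_def star_graph_def)
  have k_less: "k v < n" if "v \<in> pverts G" for v
    using img that by force
  have k_eq: "k u = k v \<longleftrightarrow> u = v" if "u \<in> pverts G" "v \<in> pverts G" for u v
    using inj that by (rule inj_on_eq_iff)
  have "(u, v) \<in> parcs G \<longleftrightarrow> (k u, k v) \<in> parcs (star_plus_edge n)"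
    if uv: "u \<in> pverts G" "v \<in> pverts G" for u v
  proof -
    have "(u, v) \<in> parcs G \<longleftrightarrow>
        u = z \<and> v \<noteq> z \<or> u \<noteq> z \<and> v = z \<or> u = x \<and> v = y \<or> u = y \<and> v = x"
      using only[of u v] star_out[of v] star_in[of u] xy xyV uv by (auto simp: doubleton_eq_iff)
    also have "\<dots> \<longleftrightarrow> k u = k z \<and> k v \<noteq> k z \<or> k u \<noteq> k z \<and> k v = k z \<or>
        k u = k x \<and> k v = k y \<or> k u = k y \<and> k v = k x"
      using uv z xyV by (simp add: k_eq)
    also have "\<dots> \<longleftrightarrow> (k u, k v) \<in> parcs (star_plus_edge n)"
      using k_less[OF uv(1)] k_less[OF uv(2)]
      by (auto simp: kzxy star_plus_edge_def star_graph_def)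
    finally show ?thesis .
  qed
  moreover have "pair_wf_digraph (star_plus_edge n)"
    using pair_graph_star_plus_edge[OF n3] by (simp add: pair_graph_def pair_digraph_def pair_fin_digraph_def)
  ultimately show ?thesis
    using bij digraph_iso_with_proj_iff[OF pair_wf_digraph] by blast
qed

section \<open>Case distinction on whether the maximum degree reaches \<open>n - 1\<close>\<close>

theorem theorem4p2:
  fixes G :: "'a pair_pre_digraph" and n :: nat and \<alpha> :: real
  assumes "unicyclic G" and "card (pverts G) = n" and "n \<ge> 4"
    and "0 \<le> \<alpha>" and "\<alpha> < 1"
  shows "gamma_alpha \<alpha> G \<le> gamma_alpha \<alpha> (star_plus_edge n) \<and>
    (gamma_alpha \<alpha> G = gamma_alpha \<alpha> (star_plus_edge n) \<longleftrightarrow>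
      digraph_iso (with_proj G) (with_proj (star_plus_edge n)))"
proof -
  interpret pair_graph G using assms(1) by (simp add: unicyclic_def)
  interpret H: pair_graph "star_plus_edge n"
    using assms(3) by (intro pair_graph_star_plus_edge) simp
  have wf: "pair_wf_digraph G" "pair_wf_digraph (star_plus_edge n)"
    by (fact pair_wf_digraph H.pair_wf_digraph)+
  have ne: "pverts G \<noteq> {}" using assms(2,3) by auto
  have deg_le: "out_degree (with_proj G) v \<le> max_degree G" if "v \<in> pverts G" for v
    using that pair_finite_verts by (simp add: max_degree_def)
  obtain z where z: "z \<in> pverts G" "out_degree (with_proj G) z = max_degree G"
    using Max_in[of "out_degree (with_proj G) ` pverts G"] ne pair_finite_verts
    unfolding max_degree_def by fastforce
  have "{w. (z, w) \<in> parcs G} \<subseteq> pverts G - {z}"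
    using in_arcsD2 no_loops'[of z z] by auto
  then have "max_degree G \<le> card (pverts G - {z})"
    unfolding z(2)[symmetric] out_degree_with_proj using pair_finite_verts by (intro card_mono) auto
  then have "max_degree G \<le> n - 1"
    using z(1) assms(2) by simp
  then consider (eq) "max_degree G = n - 1" | (less) "max_degree G < n - 1"
    by linarith
  then show ?thesis
  proof cases
    case eq
    then have iso: "digraph_iso (with_proj G) (with_proj (star_plus_edge n))"
      using unicyclic_dominating_vertex_iso[OF assms(1,2) z(1)] z(2) by simp
    have "gamma_alpha \<alpha> G = gamma_alpha \<alpha> (star_plus_edge n)"
      unfolding gamma_alpha_def max_degree_iso[OF wf iso]
        rho_alpha_iso[OF wf(1) pair_finite_verts wf(2) H.pair_finite_verts iso] ..
    then show ?thesis using iso by simp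
  next
    case less
    \<comment> \<open>An arc of the cycle shows that the maximum degree is at least 1, as the strict
      inequality requires.\<close>
    obtain p where "cycle p" "3 \<le> length p"
      using assms(1) unfolding unicyclic_def undirected_cycles_def by blast
    then obtain x y where xy: "(x, y) \<in> parcs G"
      using obtain_cycle_arc_avoiding by metis
    then have "card {w. (x, w) \<in> parcs G} \<noteq> 0"
      using finite_neighbours[of x] by auto
    then have "1 \<le> max_degree G"
      using deg_le[OF in_arcsD1[OF xy]] unfolding out_degree_with_proj by linarith
    then have strict: "gamma_alpha \<alpha> G < gamma_alpha \<alpha> (star_plus_edge n)"
      using gamma_alpha_less_star_plus_edge assms(2-5) less by blast
    \<comment> \<open>Isomorphism preserves the maximum degree, which is \<open>n - 1\<close> for
      \<open>star_plus_edge n\<close>; thus both sides of the equality criterion are false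
      here.\<close>
    have "\<not> digraph_iso (with_proj G) (with_proj (star_plus_edge n))"
      using max_degree_iso[OF wf] max_degree_star_plus_edge[of n] assms(3) less by auto
    then show ?thesis using strict by simp
  qed
qed

end
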